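(* Let $n\ge 2$ be an integer with prime decomposition $n = p_1^{y_1}\cdots p_r^{y_r}$ (the $p_i$ pairwise distinct primes, $y_i>0$), and let $m=\gcd(p_1^{y_1}-1,\dots,p_r^{y_r}-1)$. Then, for all $k\ge 2$ and all $c\ge 1$, $$\gamma_k(\Gamma_{n,c})=\left\langle \overline{a}^{\,m^{k-1}}\right\rangle .$$
   Context: The group $\Gamma_n$ is $$\Gamma_n=\left\langle a,t_1,\dots,t_r \ \middle|\ t_it_j=t_jt_i\ (i\neq j),\ t_i a t_i^{-1}=a^{p_i^{y_i}}\ (1\le i\le r)\right\rangle.$$ The lower central series of a group $G$ is $\gamma_1(G)=G$, $\gamma_{k+1}(G)=[\gamma_k(G),G]$ for $k\geq 1$. For $c\ge 1$, $\Gamma_{n,c}=\Gamma_n/\gamma_{c+1}(\Gamma_n)$, and $\overline{a}=a\gamma_{c+1}(\Gamma_n)\in\Gamma_{n,c}$ is the image of $a$. *)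

theory Defs
  imports "HOL-Algebra.Generated_Groups" "HOL-Computational_Algebra.Primes"
begin

section \<open>Free groups and group presentations\<close>

text \<open>
  A word over the generators X is a list of letters \<open>(x, b)\<close> with \<open>x \<in> X\<close>, where
  \<open>(x, True)\<close> stands for \<open>x\<close> and \<open>(x, False)\<close> for its formal inverse. The free group
  consists of the classes of words modulo insertion and deletion of adjacent mutually
  inverse letters.
\<close>

type_synonym 'a word = "('a \<times> bool) list"

definition words :: "'a set \<Rightarrow> 'a word set" where
  "words X = lists (X \<times> UNIV)"

definition cancel :: "'a set \<Rightarrow> ('a word \<times> 'a word) set" where
  "cancel X = {(u @ [(x, b), (x, \<not> b)] @ v, u @ v) | u v x b.
                 u \<in> words X \<and> v \<in> words X \<and> x \<in> X}"

definition free_eq :: "'a set \<Rightarrow> ('a word \<times> 'a word) set" where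
  "free_eq X = Restr ((cancel X \<union> (cancel X)\<inverse>)\<^sup>*) (words X)"

definition free_group :: "'a set \<Rightarrow> 'a word set monoid" where
  "free_group X =
     \<lparr>carrier = words X // free_eq X,
      monoid.mult = (\<lambda>A B. \<Union>u\<in>A. \<Union>v\<in>B. free_eq X `` {u @ v}),
      one = free_eq X `` {[]}\<rparr>"

definition free_gen :: "'a set \<Rightarrow> 'a \<Rightarrow> 'a word set" where
  "free_gen X x = free_eq X `` {[(x, True)]}"

definition normal_closure :: "('a, 'b) monoid_scheme \<Rightarrow> 'a set \<Rightarrow> 'a set" where
  "normal_closure G S = \<Inter> {N. N \<lhd> G \<and> S \<subseteq> N}"

text \<open>
  The relations are pairs \<open>(u, v)\<close> of elements of the free group, read as \<open>u = v\<close>.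
\<close>

definition relators :: "'a set \<Rightarrow> ('a word set \<times> 'a word set) set \<Rightarrow> 'a word set set" where
  "relators X R =
     normal_closure (free_group X)
       {u \<otimes>\<^bsub>free_group X\<^esub> inv\<^bsub>free_group X\<^esub> v | u v. (u, v) \<in> R}"

definition presented_group ::
    "'a set \<Rightarrow> ('a word set \<times> 'a word set) set \<Rightarrow> 'a word set set monoid" where
  "presented_group X R = free_group X Mod relators X R"

definition presented_gen ::
    "'a set \<Rightarrow> ('a word set \<times> 'a word set) set \<Rightarrow> 'a \<Rightarrow> 'a word set set" where
  "presented_gen X R x = relators X R #>\<^bsub>free_group X\<^esub> free_gen X x"


section \<open>Lower central series\<close>

definition commutator_subgroup ::
    "('a, 'b) monoid_scheme \<Rightarrow> 'a set \<Rightarrow> 'a set \<Rightarrow> 'a set" where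
  "commutator_subgroup G H K =
     generate G {x \<otimes>\<^bsub>G\<^esub> y \<otimes>\<^bsub>G\<^esub> inv\<^bsub>G\<^esub> x \<otimes>\<^bsub>G\<^esub> inv\<^bsub>G\<^esub> y | x y. x \<in> H \<and> y \<in> K}"

text \<open>The series starts at index 1; the value at index 0 is a dummy.\<close>

fun lower_central :: "('a, 'b) monoid_scheme \<Rightarrow> nat \<Rightarrow> 'a set" where
  "lower_central G 0 = carrier G"
| "lower_central G (Suc 0) = carrier G"
| "lower_central G (Suc (Suc k)) =
     commutator_subgroup G (lower_central G (Suc k)) (carrier G)"


section \<open>The groups \<open>\<Gamma>\<^sub>n\<close> and \<open>\<Gamma>\<^sub>n\<^sub>,\<^sub>c\<close>\<close>

text \<open>
  The group \<open>\<Gamma>\<^sub>n\<close> is written \<open>Gamma r p y\<close>, in terms of the prime decomposition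
  \<open>n = (\<Prod>i = 1..r. p i ^ y i)\<close>.
\<close>

datatype gen = A | T nat

definition Gamma_gens :: "nat \<Rightarrow> gen set" where
  "Gamma_gens r = insert A (T ` {1..r})"

definition Gamma_rels ::
    "nat \<Rightarrow> (nat \<Rightarrow> nat) \<Rightarrow> (nat \<Rightarrow> nat) \<Rightarrow> (gen word set \<times> gen word set) set" where
  "Gamma_rels r p y =
     (let F = free_group (Gamma_gens r);
          a = free_gen (Gamma_gens r) A;
          t = (\<lambda>i. free_gen (Gamma_gens r) (T i))
      in {(t i \<otimes>\<^bsub>F\<^esub> t j, t j \<otimes>\<^bsub>F\<^esub> t i) | i j. i \<in> {1..r} \<and> j \<in> {1..r} \<and> i \<noteq> j} \<union>
         {(t i \<otimes>\<^bsub>F\<^esub> a \<otimes>\<^bsub>F\<^esub> inv\<^bsub>F\<^esub> (t i), a [^]\<^bsub>F\<^esub> (p i ^ y i)) | i. i \<in> {1..r}})"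

definition Gamma ::
    "nat \<Rightarrow> (nat \<Rightarrow> nat) \<Rightarrow> (nat \<Rightarrow> nat) \<Rightarrow> gen word set set monoid" where
  "Gamma r p y = presented_group (Gamma_gens r) (Gamma_rels r p y)"

definition Gamma_a :: "nat \<Rightarrow> (nat \<Rightarrow> nat) \<Rightarrow> (nat \<Rightarrow> nat) \<Rightarrow> gen word set set" where
  "Gamma_a r p y = presented_gen (Gamma_gens r) (Gamma_rels r p y) A"

definition Gamma_nil ::
    "nat \<Rightarrow> (nat \<Rightarrow> nat) \<Rightarrow> (nat \<Rightarrow> nat) \<Rightarrow> nat \<Rightarrow> gen word set set set monoid" where
  "Gamma_nil r p y c = Gamma r p y Mod lower_central (Gamma r p y) (c + 1)"

definition a_bar ::
    "nat \<Rightarrow> (nat \<Rightarrow> nat) \<Rightarrow> (nat \<Rightarrow> nat) \<Rightarrow> nat \<Rightarrow> gen word set set set" where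
  "a_bar r p y c = lower_central (Gamma r p y) (c + 1) #>\<^bsub>Gamma r p y\<^esub> Gamma_a r p y"

end

theory Submission
  imports Defs
begin

text \<open>
  Write \<open>q\<^sub>i = p\<^sub>i ^ y\<^sub>i\<close> and work in \<open>N = \<Gamma>\<^sub>n\<^sub>,\<^sub>c\<close>, which is generated by \<open>a\<close> and the commuting
  elements \<open>t\<^sub>i\<close>, satisfies \<open>t\<^sub>i a t\<^sub>i\<^sup>-\<^sup>1 = a ^ q\<^sub>i\<close>, and has trivial \<open>\<gamma>\<^sub>c\<^sub>+\<^sub>1\<close>.

  In \<open>\<Gamma>\<^sub>n\<close> itself conjugation by \<open>t\<^sub>i\<^sup>-\<^sup>1\<close> may lead out of \<open>\<langle>a\<rangle>\<close>. In \<open>N\<close> it does not: since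
  \<open>[a ^ j, t\<^sub>i] = a ^ (j (1 - q\<^sub>i))\<close>, iterated commutators with \<open>t\<^sub>i\<close> put \<open>a ^ ((1 - q\<^sub>i) ^ c)\<close> into
  the trivial \<open>\<gamma>\<^sub>c\<^sub>+\<^sub>1\<close>, and \<open>q\<^sub>i\<close> is coprime to \<open>(1 - q\<^sub>i) ^ c\<close>; so the \<open>q\<^sub>i\<close>-th power map on
  \<open>\<langle>a\<rangle>\<close> has an inverse, which is again a power map. The exponents \<open>q\<^sub>i\<close> and their inverses are
  congruent to 1 modulo \<open>m\<close>. Hence every \<open>x\<close> in \<open>N\<close> acts by \<open>x a x\<^sup>-\<^sup>1 = a ^ e\<close> with
  \<open>m dvd e - 1\<close> (lemma \<open>conj_a_exponent\<close>).

  This gives one inclusion. All subgroups \<open>\<langle>a ^ d\<rangle>\<close> are normal, the generators commute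
  modulo \<open>\<langle>a ^ m\<rangle>\<close>, so \<open>\<gamma>\<^sub>2\<close> lies in \<open>\<langle>a ^ m\<rangle>\<close>; and \<open>[a ^ j, x] = a ^ (j (1 - e))\<close> gains one factor
  \<open>m\<close> at each further step. For the other inclusion, if \<open>a ^ b\<close> is in \<open>\<gamma>\<^sub>k\<close>, then the commutators
  with the \<open>t\<^sub>i\<close> show that all \<open>a ^ (b (q\<^sub>i - 1))\<close> are in \<open>\<gamma>\<^sub>k\<^sub>+\<^sub>1\<close>, and by Bezout so is \<open>a ^ (b m)\<close>
  (lemma \<open>int_pow_Gcd_in_subgroup\<close>).

  It remains to see that \<open>N\<close> has the stated properties. The free group is a group generated by
  its free generators, so its quotient is generated by their images and satisfies the relations;
  and surjective homomorphisms carry the lower central series onto the lower central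
  series (lemma \<open>lower_central_image\<close>), so that of \<open>\<Gamma>\<^sub>n / \<gamma>\<^sub>c\<^sub>+\<^sub>1(\<Gamma>\<^sub>n)\<close> is trivial from \<open>c + 1\<close> on.
\<close>

section \<open>Commutators and the lower central series\<close>

context group
begin

definition commutator :: "'a \<Rightarrow> 'a \<Rightarrow> 'a" where
  "commutator x y = x \<otimes> y \<otimes> inv x \<otimes> inv y"

lemma mult_inv_cancel_left:
  assumes "x \<in> carrier G" "y \<in> carrier G"
  shows "x \<otimes> (inv x \<otimes> y) = y" "inv x \<otimes> (x \<otimes> y) = y"
  using assms by (simp_all flip: m_assoc)

text \<open>
  Together with the simplification rules for units and inverses, these bring group words into
  reduced, right-associated form; this decides the identities that hold in free groups.
\<close>

lemmas group_normalize = m_assoc inv_mult_group mult_inv_cancel_left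

lemma commutator_closed [simp]:
  "\<lbrakk>x \<in> carrier G; y \<in> carrier G\<rbrakk> \<Longrightarrow> commutator x y \<in> carrier G"
  by (simp add: commutator_def)

lemma inv_commutator:
  "\<lbrakk>x \<in> carrier G; y \<in> carrier G\<rbrakk> \<Longrightarrow> inv (commutator x y) = commutator y x"
  by (simp add: commutator_def group_normalize)

lemma commutator_mult_left:
  assumes "x \<in> carrier G" "x' \<in> carrier G" "y \<in> carrier G"
  shows "commutator (x \<otimes> x') y = x \<otimes> commutator x' y \<otimes> inv x \<otimes> commutator x y"
  using assms by (simp add: commutator_def group_normalize)

lemma commutator_inv_left:
  assumes "x \<in> carrier G" "y \<in> carrier G"
  shows "commutator (inv x) y = inv x \<otimes> inv (commutator x y) \<otimes> x"
  using assms by (simp add: commutator_def group_normalize)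

lemma commutator_one_left: "y \<in> carrier G \<Longrightarrow> commutator \<one> y = \<one>"
  by (simp add: commutator_def)

lemma commutator_eq_one:
  assumes "x \<in> carrier G" "y \<in> carrier G" "x \<otimes> y = y \<otimes> x"
  shows "commutator x y = \<one>"
  using assms by (simp add: commutator_def group_normalize)

lemma commutator_subgroup_eq_generate:
  "commutator_subgroup G H K = generate G {commutator x y | x y. x \<in> H \<and> y \<in> K}"
  by (simp add: commutator_subgroup_def commutator_def)

lemma commutator_subgroup_subset:
  assumes "subgroup L G" "\<And>x y. \<lbrakk>x \<in> H; y \<in> K\<rbrakk> \<Longrightarrow> commutator x y \<in> L"
  shows "commutator_subgroup G H K \<subseteq> L"
  unfolding commutator_subgroup_eq_generate
  by (rule generate_subgroup_incl) (use assms in auto)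

text \<open>
  Conjugation distributes over commutators, so it permutes the generating set.
\<close>

lemma commutator_subgroup_normal:
  assumes "H \<lhd> G"
  shows "commutator_subgroup G H (carrier G) \<lhd> G"
  unfolding commutator_subgroup_eq_generate
proof (rule normal_generateI)
  interpret H: normal H G by fact
  show "{commutator x y | x y. x \<in> H \<and> y \<in> carrier G} \<subseteq> carrier G"
    by auto
  fix h g assume "h \<in> {commutator x y | x y. x \<in> H \<and> y \<in> carrier G}" and g: "g \<in> carrier G"
  then obtain x y where h: "h = commutator x y" "x \<in> H" "y \<in> carrier G"
    by auto
  have "g \<otimes> h \<otimes> inv g = commutator (g \<otimes> x \<otimes> inv g) (g \<otimes> y \<otimes> inv g)"
    using h g by (simp add: commutator_def group_normalize)
  moreover have "g \<otimes> x \<otimes> inv g \<in> H"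
    using h g by (simp add: H.inv_op_closed2)
  ultimately show "g \<otimes> h \<otimes> inv g \<in> {commutator x y | x y. x \<in> H \<and> y \<in> carrier G}"
    using h g by auto
qed

text \<open>
  A group is abelian modulo \<open>N\<close> as soon as its generators commute modulo \<open>N\<close>. For fixed \<open>y\<close> the
  elements that commute with \<open>y\<close> modulo \<open>N\<close> form a subgroup; this is applied first with a
  generator and then with an arbitrary element as \<open>y\<close>.
\<close>

lemma commutator_in_normal_of_generators:
  assumes "N \<lhd> G" and S: "S \<subseteq> carrier G" "generate G S = carrier G"
    and gens: "\<And>x y. \<lbrakk>x \<in> S; y \<in> S\<rbrakk> \<Longrightarrow> commutator x y \<in> N"
    and "x \<in> carrier G" "y \<in> carrier G"
  shows "commutator x y \<in> N"
proof -
  interpret N: normal N G by fact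
  have extend: "commutator x y \<in> N"
    if y: "y \<in> carrier G" and *: "\<And>x. x \<in> S \<Longrightarrow> commutator x y \<in> N" and "x \<in> carrier G"
    for x y
  proof -
    have "subgroup {x \<in> carrier G. commutator x y \<in> N} G"
    proof
      fix u v assume u: "u \<in> {x \<in> carrier G. commutator x y \<in> N}"
        and v: "v \<in> {x \<in> carrier G. commutator x y \<in> N}"
      then show "u \<otimes> v \<in> {x \<in> carrier G. commutator x y \<in> N}"
        using y by (simp add: commutator_mult_left N.inv_op_closed2)
    next
      fix u assume u: "u \<in> {x \<in> carrier G. commutator x y \<in> N}"
      then show "inv u \<in> {x \<in> carrier G. commutator x y \<in> N}"
        using y by (simp add: commutator_inv_left N.inv_op_closed1)
    qed (use y in \<open>auto simp: commutator_one_left\<close>)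
    then have "generate G S \<subseteq> {x \<in> carrier G. commutator x y \<in> N}"
      using S * by (intro generate_subgroup_incl) auto
    then show ?thesis
      using S \<open>x \<in> carrier G\<close> by auto
  qed
  have "commutator s y \<in> N" if "s \<in> S" for s
  proof -
    have "commutator y s \<in> N"
      using that S \<open>y \<in> carrier G\<close> by (intro extend[of s y] gens) auto
    then have "inv (commutator y s) \<in> N"
      by (rule N.m_inv_closed)
    then show ?thesis
      using that S \<open>y \<in> carrier G\<close> by (simp add: inv_commutator subsetD)
  qed
  with \<open>y \<in> carrier G\<close> show ?thesis
    using \<open>x \<in> carrier G\<close> by (rule extend)
qed

lemma lower_central_Suc:
  "k \<ge> 1 \<Longrightarrow> lower_central G (Suc k) = commutator_subgroup G (lower_central G k) (carrier G)"
  by (cases k) auto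

lemma lower_central_normal: "lower_central G k \<lhd> G"
proof (induction k)
  case (Suc k)
  then show ?case
    by (cases k) (auto intro: normal_self commutator_subgroup_normal)
qed (auto intro: normal_self)

lemma commutator_in_lower_central:
  assumes "k \<ge> 1" "x \<in> lower_central G k" "y \<in> carrier G"
  shows "commutator x y \<in> lower_central G (Suc k)"
  using assms by (auto simp: lower_central_Suc commutator_subgroup_eq_generate intro!: generate.incl)

end

lemma (in normal) group_hom_Mod: "group_hom G (G Mod H) (\<lambda>x. H #> x)"
  using r_coset_hom_Mod factorgroup_is_group
  by (simp add: group_hom_def group_hom_axioms_def is_group)

context group_hom
begin

lemma commutator_image:
  "\<lbrakk>x \<in> carrier G; y \<in> carrier G\<rbrakk> \<Longrightarrow> h (G.commutator x y) = H.commutator (h x) (h y)"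
  by (simp add: G.commutator_def H.commutator_def)

lemma commutator_subgroup_image:
  assumes "K \<subseteq> carrier G" "L \<subseteq> carrier G"
  shows "commutator_subgroup H (h ` K) (h ` L) = h ` commutator_subgroup G K L"
proof -
  have "{H.commutator x y | x y. x \<in> h ` K \<and> y \<in> h ` L}
      = h ` {G.commutator x y | x y. x \<in> K \<and> y \<in> L}"
    using assms by (force simp: commutator_image subset_iff)
  then show ?thesis
    unfolding H.commutator_subgroup_eq_generate G.commutator_subgroup_eq_generate
    using assms by (simp add: generate_img subset_iff) (auto intro!: generate_img)
qed

text \<open>
  Surjectivity is needed because the second argument of each commutator ranges over the whole
  group.
\<close>

lemma lower_central_image:
  assumes "h ` carrier G = carrier H"
  shows "lower_central H k = h ` lower_central G k"
proof (induction k)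
  case (Suc k)
  show ?case
  proof (cases "k = 0")
    case False
    interpret L: normal "lower_central G k" G by (rule G.lower_central_normal)
    show ?thesis
      using False Suc commutator_subgroup_image[OF L.subset order_refl]
      by (simp add: G.lower_central_Suc H.lower_central_Suc assms)
  qed (simp add: assms)
qed (simp add: assms)

end

lemma (in group) lower_central_Mod_self:
  "lower_central (G Mod lower_central G k) k = {\<one>\<^bsub>G Mod lower_central G k\<^esub>}"
proof -
  interpret L: normal "lower_central G k" G by (rule lower_central_normal)
  interpret h: group_hom G "G Mod lower_central G k" "\<lambda>x. lower_central G k #> x"
    by (rule L.group_hom_Mod)
  have "lower_central (G Mod lower_central G k) k = (\<lambda>x. lower_central G k #> x) ` lower_central G k"
    by (rule h.lower_central_image) (simp add: carrier_FactGroup)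
  also have "\<dots> = {lower_central G k}"
    using L.rcos_const[OF is_group] L.one_closed by (auto intro!: image_eqI[of _ _ \<one>])
  finally show ?thesis by simp
qed

section \<open>Powers of an element under conjugation\<close>

context group
begin

lemma conj_int_pow:
  assumes "x \<in> carrier G" "y \<in> carrier G"
  shows "y \<otimes> x [^] (j :: int) \<otimes> inv y = (y \<otimes> x \<otimes> inv y) [^] j"
proof -
  have "(\<lambda>x. y \<otimes> x \<otimes> inv y) \<in> hom G G"
    using assms by (auto intro!: homI simp: group_normalize)
  then interpret group_hom G G "\<lambda>x. y \<otimes> x \<otimes> inv y"
    by unfold_locales
  show ?thesis
    using hom_int_pow[of x j] assms by simp
qed

text \<open>
  The computation behind both inclusions: if \<open>y\<close> raises \<open>a\<close> to the power \<open>e\<close>, commuting with \<open>y\<close>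
  multiplies exponents of \<open>a\<close> by \<open>1 - e\<close>.
\<close>

lemma commutator_int_pow:
  assumes "a \<in> carrier G" "y \<in> carrier G" "y \<otimes> a \<otimes> inv y = a [^] (e :: int)"
  shows "commutator (a [^] (j :: int)) y = a [^] (j * (1 - e))"
proof -
  have "commutator (a [^] j) y = a [^] j \<otimes> (y \<otimes> a [^] (- j) \<otimes> inv y)"
    using assms by (simp add: commutator_def int_pow_neg m_assoc)
  also have "\<dots> = a [^] j \<otimes> a [^] (e * - j)"
    using assms by (simp only: conj_int_pow int_pow_pow)
  also have "\<dots> = a [^] (j * (1 - e))"
    using assms by (simp add: int_pow_mult algebra_simps flip: int_pow_mult)
  finally show ?thesis .
qed

text \<open>
  The exponents \<open>j\<close> with \<open>a [^] (b * j) \<in> H\<close> form an ideal of the integers, so with the elements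
  of \<open>D\<close> it contains their greatest common divisor.
\<close>

lemma int_pow_Gcd_in_subgroup:
  fixes D :: "nat set" and b :: int
  assumes "subgroup H G" "a \<in> carrier G" "finite D"
    and "\<And>d. d \<in> D \<Longrightarrow> a [^] (b * int d) \<in> H"
  shows "a [^] (b * int (Gcd D)) \<in> H"
  using assms(3,4)
proof (induction D)
  case empty
  then show ?case using subgroup.one_closed[OF assms(1)] by simp
next
  case (insert d D)
  obtain u v where uv: "u * int d + v * int (Gcd D) = gcd (int d) (int (Gcd D))"
    using bezout_int by blast
  have "b * int (Gcd (insert d D)) = b * gcd (int d) (int (Gcd D))"
    by (simp add: gcd_int_int_eq)
  also have "\<dots> = b * int d * u + b * int (Gcd D) * v"
    unfolding uv[symmetric] by (simp add: algebra_simps)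
  finally have "a [^] (b * int (Gcd (insert d D)))
      = (a [^] (b * int d)) [^] u \<otimes> (a [^] (b * int (Gcd D))) [^] v"
    using assms(2) by (simp add: int_pow_pow int_pow_mult)
  also have "\<dots> \<in> H"
    using insert
    by (auto intro!: subgroup.m_closed[OF assms(1)] subgroup_int_pow_closed[OF assms(1), of "a [^] _"])
  finally show ?case .
qed

lemma int_pow_mem_generate_iff:
  assumes "a \<in> carrier G"
  shows "x \<in> generate G {a [^] (d::int)} \<longleftrightarrow> (\<exists>j. d dvd j \<and> x = a [^] j)"
  using assms by (auto simp: generate_pow int_pow_pow dvd_def)

end

section \<open>Nilpotent groups with a power action\<close>

text \<open>
  The properties of \<open>\<Gamma>\<^sub>n\<^sub>,\<^sub>c\<close> on which its lower central series depends, with \<open>q i\<close> in the place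
  of the prime power \<open>p i ^ y i\<close>.
\<close>

locale power_action = group +
  fixes a :: 'a and I :: "'i set" and t :: "'i \<Rightarrow> 'a" and q :: "'i \<Rightarrow> nat" and c :: nat
  assumes finite_I: "finite I"
    and a_closed [simp]: "a \<in> carrier G"
    and t_closed [simp]: "i \<in> I \<Longrightarrow> t i \<in> carrier G"
    and generated: "generate G (insert a (t ` I)) = carrier G"
    and t_commute: "\<lbrakk>i \<in> I; j \<in> I\<rbrakk> \<Longrightarrow> t i \<otimes> t j = t j \<otimes> t i"
    and conj_a: "i \<in> I \<Longrightarrow> t i \<otimes> a \<otimes> inv (t i) = a [^] q i"
    and q_pos: "i \<in> I \<Longrightarrow> q i \<ge> 1"
    and c_pos: "c \<ge> 1"
    and nilpotent: "lower_central G (Suc c) = {\<one>}"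
begin

definition m :: int where
  "m = int (Gcd ((\<lambda>i. q i - 1) ` I))"

lemma m_dvd: "i \<in> I \<Longrightarrow> m dvd int (q i) - 1"
proof -
  assume "i \<in> I"
  then have "Gcd ((\<lambda>i. q i - 1) ` I) dvd q i - 1" by (intro Gcd_dvd) simp
  then have "m dvd int (q i - 1)" by (simp only: m_def int_dvd_int_iff)
  then show ?thesis using q_pos[OF \<open>i \<in> I\<close>] by (simp add: of_nat_diff)
qed

lemma conj_a_int: "i \<in> I \<Longrightarrow> t i \<otimes> a \<otimes> inv (t i) = a [^] int (q i)"
  by (simp add: conj_a int_pow_int)

text \<open>
  Each commutator with \<open>t i\<close> multiplies the exponent by \<open>1 - q i\<close>. With nilpotency this bounds the
  order of \<open>a\<close>.
\<close>

lemma a_pow_in_lower_central: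
  assumes i: "i \<in> I" and "k \<ge> 1"
  shows "a [^] ((1 - int (q i)) ^ (k - 1)) \<in> lower_central G k"
  using \<open>k \<ge> 1\<close>
proof (induction k rule: nat_induct_at_least)
  case base
  then show ?case by simp
next
  case (Suc k)
  then have "(1 - int (q i)) ^ (Suc k - 1) = (1 - int (q i)) ^ (k - 1) * (1 - int (q i))"
    by (cases k) auto
  then have "commutator (a [^] ((1 - int (q i)) ^ (k - 1))) (t i)
      = a [^] ((1 - int (q i)) ^ (Suc k - 1))"
    using i by (simp only: commutator_int_pow[OF a_closed t_closed conj_a_int])
  then show ?case
    using commutator_in_lower_central[OF Suc(1,2)] i by (metis t_closed)
qed

lemma a_pow_eq_one: "i \<in> I \<Longrightarrow> a [^] ((1 - int (q i)) ^ c) = \<one>"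
  using a_pow_in_lower_central[of i "Suc c"] nilpotent by simp

text \<open>
  Conjugation by \<open>t i\<close> raises \<open>a\<close> to the power \<open>q i\<close>, and \<open>q i\<close> is invertible modulo
  \<open>(1 - q i) ^ c\<close>, which annihilates \<open>a\<close>; an inverse \<open>s\<close> of it is the exponent of \<open>inv (t i)\<close>.
  As \<open>c\<close> is positive, \<open>s\<close> is also an inverse of \<open>q i\<close> modulo \<open>1 - q i\<close>, where \<open>q i\<close> is 1.
\<close>

lemma conj_a_inv_t:
  assumes i: "i \<in> I"
  shows "\<exists>e. m dvd e - 1 \<and> inv (t i) \<otimes> a \<otimes> t i = a [^] (e :: int)"
proof -
  define d where "d = 1 - int (q i)"
  have "coprime (int (q i)) (d ^ c)"
  proof -
    have "coprime (int (q i)) d"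
    proof (rule coprimeI)
      fix x assume "x dvd int (q i)" "x dvd d"
      then have "x dvd int (q i) + d" by (rule dvd_add)
      then show "is_unit x" by (simp add: d_def)
    qed
    then show ?thesis by simp
  qed
  then obtain s v where s: "s * int (q i) + v * d ^ c = 1"
    using bezout_int[of "int (q i)" "d ^ c"] by (metis coprime_iff_gcd_eq_1)
  have "d dvd d ^ c"
    using c_pos by (simp add: dvd_power)
  then obtain w where "d ^ c = d * w" by (elim dvdE)
  with s have "s * int (q i) + v * (d * w) = 1" by simp
  moreover have "s * int (q i) = s - s * d"
    by (simp add: d_def algebra_simps)
  ultimately have "s - 1 = d * (s - v * w)"
    by (simp add: algebra_simps)
  moreover have "m dvd d"
    using m_dvd[OF i] by (simp add: d_def dvd_diff_commute)
  ultimately have "m dvd s - 1" by simp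
  have "t i \<otimes> a [^] s \<otimes> inv (t i) = a [^] (int (q i) * s)"
    using i by (simp add: conj_int_pow conj_a_int int_pow_pow)
  also have "int (q i) * s = 1 + d ^ c * (- v)"
    using s by (simp add: algebra_simps)
  also have "a [^] (1 + d ^ c * (- v)) = a [^] (1 :: int) \<otimes> (a [^] (d ^ c)) [^] (- v)"
    by (simp only: int_pow_mult int_pow_pow a_closed)
  also have "\<dots> = a"
    using a_pow_eq_one[OF i] by (simp add: d_def)
  finally have "inv (t i) \<otimes> a \<otimes> t i = inv (t i) \<otimes> (t i \<otimes> a [^] s \<otimes> inv (t i)) \<otimes> t i"
    by simp
  also have "\<dots> = a [^] s"
    using i by (simp add: group_normalize)
  finally show ?thesis
    using \<open>m dvd s - 1\<close> by blast
qed

text \<open>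
  The congruence to 1 modulo \<open>m\<close> holds for the exponents of the generators and their inverses, and
  composing conjugations multiplies exponents.
\<close>

lemma conj_a_exponent:
  assumes "x \<in> carrier G"
  shows "\<exists>e. m dvd e - 1 \<and> x \<otimes> a \<otimes> inv x = a [^] (e :: int)"
proof -
  have "x \<in> generate G (insert a (t ` I))"
    using assms generated by simp
  then show ?thesis
  proof induction
    case one
    show ?case by (rule exI[of _ 1]) simp
  next
    case (incl h)
    then consider "h = a" | i where "i \<in> I" "h = t i" by auto
    then show ?case
    proof cases
      case 1
      then show ?thesis by (intro exI[of _ 1]) (simp add: m_assoc)
    next
      case 2
      then show ?thesis using m_dvd conj_a_int by blast
    qed
  next
    case (inv h)
    then consider "h = a" | i where "i \<in> I" "h = t i" by auto
    then show ?case
    proof cases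
      case 1
      then show ?thesis by (intro exI[of _ 1]) simp
    next
      case 2
      then show ?thesis using conj_a_inv_t[of i] by simp
    qed
  next
    case (eng x y)
    then have [simp]: "x \<in> carrier G" "y \<in> carrier G"
      using generated by auto
    obtain e f where e: "m dvd e - 1" "x \<otimes> a \<otimes> inv x = a [^] e"
      and f: "m dvd f - 1" "y \<otimes> a \<otimes> inv y = a [^] f"
      using eng by blast
    have "x \<otimes> y \<otimes> a \<otimes> inv (x \<otimes> y) = x \<otimes> (y \<otimes> a \<otimes> inv y) \<otimes> inv x"
      by (simp add: group_normalize)
    also have "\<dots> = a [^] (e * f)"
      by (simp add: f conj_int_pow e int_pow_pow)
    finally have "x \<otimes> y \<otimes> a \<otimes> inv (x \<otimes> y) = a [^] (e * f)" .
    moreover have "m dvd (e - 1) * f + (f - 1)"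
      using e f by simp
    then have "m dvd e * f - 1"
      by (simp add: algebra_simps)
    ultimately show ?case by blast
  qed
qed

lemma generate_a_pow_normal: "generate G {a [^] (d :: int)} \<lhd> G"
proof (rule normal_invI)
  show "subgroup (generate G {a [^] d}) G"
    by (rule generate_is_subgroup) simp
  fix h x assume "h \<in> generate G {a [^] d}" and x: "x \<in> carrier G"
  then obtain j where j: "d dvd j" "h = a [^] j"
    by (auto simp: int_pow_mem_generate_iff)
  obtain e where "x \<otimes> a \<otimes> inv x = a [^] (e :: int)"
    using conj_a_exponent[OF x] by blast
  then have "x \<otimes> h \<otimes> inv x = a [^] (e * j)"
    using x by (simp add: j conj_int_pow int_pow_pow)
  then show "x \<otimes> h \<otimes> inv x \<in> generate G {a [^] d}"
    using j by (auto simp: int_pow_mem_generate_iff intro: dvd_mult)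
qed

lemma commutator_in_generate_a_pow:
  assumes "x \<in> carrier G" "y \<in> carrier G"
  shows "commutator x y \<in> generate G {a [^] m}"
proof (rule commutator_in_normal_of_generators[OF generate_a_pow_normal _ generated])
  have one: "\<one> \<in> generate G {a [^] m}" by (rule generate.one)
  have at: "commutator a (t i) \<in> generate G {a [^] m}" if "i \<in> I" for i
    using that commutator_int_pow[OF a_closed t_closed conj_a_int, where j = 1] m_dvd[of i]
    by (auto simp: int_pow_mem_generate_iff dvd_diff_commute)
  have ta: "commutator (t i) a \<in> generate G {a [^] m}" if "i \<in> I" for i
    using generate_m_inv_closed[OF _ at[OF that]] that by (simp add: inv_commutator)
  fix x y assume "x \<in> insert a (t ` I)" "y \<in> insert a (t ` I)"
  then show "commutator x y \<in> generate G {a [^] m}"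
    using at ta one by (auto simp: t_commute commutator_eq_one)
qed (use assms in auto)

text \<open>
  Induction on \<open>k\<close>. Passing from \<open>\<gamma>\<^sub>k\<close> to \<open>\<gamma>\<^sub>k\<^sub>+\<^sub>1\<close> multiplies the exponent by \<open>m\<close>: at most that much
  is in \<open>\<gamma>\<^sub>k\<^sub>+\<^sub>1\<close> since all exponents of conjugation are 1 modulo \<open>m\<close>, at least that much since \<open>m\<close> is
  a combination of the \<open>q i - 1\<close>. The first step from \<open>\<gamma>\<^sub>1\<close> is different for the upper bound, as
  \<open>\<gamma>\<^sub>1\<close> does not consist of powers of \<open>a\<close>.
\<close>

theorem lower_central_eq_generate:
  assumes "k \<ge> 2"
  shows "lower_central G k = generate G {a [^] (m ^ (k - 1))}"
  using assms
proof (induction k rule: nat_induct_at_least)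
  have lower_central_superset: "generate G {a [^] (b * m)} \<subseteq> lower_central G (Suc k)"
    if "k \<ge> 1" and b: "a [^] b \<in> lower_central G k" for b and k
  proof -
    interpret L: normal "lower_central G (Suc k)" G by (rule lower_central_normal)
    have "a [^] (b * int (q i - 1)) \<in> lower_central G (Suc k)" if i: "i \<in> I" for i
    proof -
      have "commutator (a [^] b) (t i) = a [^] (b * (1 - int (q i)))"
        using i by (simp add: commutator_int_pow[OF _ _ conj_a_int])
      then have "a [^] (b * (1 - int (q i))) \<in> lower_central G (Suc k)"
        using commutator_in_lower_central[OF \<open>k \<ge> 1\<close> b t_closed[OF i]] by simp
      then have "inv (a [^] (b * (1 - int (q i)))) \<in> lower_central G (Suc k)"
        by (rule L.m_inv_closed)
      moreover have "- (b * (1 - int (q i))) = b * int (q i - 1)"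
        using q_pos[OF i] by (simp add: of_nat_diff algebra_simps)
      ultimately show ?thesis
        by (metis int_pow_neg a_closed)
    qed
    then have "a [^] (b * m) \<in> lower_central G (Suc k)"
      unfolding m_def
      by (intro int_pow_Gcd_in_subgroup) (auto simp: finite_I L.subgroup_axioms)
    then show ?thesis
      by (intro generate_subgroup_incl L.subgroup_axioms) simp
  qed
  {
    case base
    have "lower_central G (Suc 1) \<subseteq> generate G {a [^] m}"
      unfolding lower_central_Suc[OF order_refl]
      by (rule commutator_subgroup_subset)
        (auto intro: generate_is_subgroup commutator_in_generate_a_pow)
    moreover have "generate G {a [^] m} \<subseteq> lower_central G (Suc 1)"
      using lower_central_superset[of 1 1] by simp
    ultimately show ?case
      by (simp add: numeral_2_eq_2)
  next
    case (Suc k)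
    then have pow: "m ^ (Suc k - 1) = m ^ (k - 1) * m"
      by (cases k) auto
    have "lower_central G (Suc k) \<subseteq> generate G {a [^] (m ^ (k - 1) * m)}"
      unfolding lower_central_Suc[OF order_trans[OF one_le_numeral Suc(1)]]
    proof (rule commutator_subgroup_subset)
      fix x y assume x: "x \<in> lower_central G k" and y: "y \<in> carrier G"
      then obtain j where j: "m ^ (k - 1) dvd j" "x = a [^] j"
        using Suc by (auto simp: int_pow_mem_generate_iff)
      obtain e where e: "m dvd e - 1" "y \<otimes> a \<otimes> inv y = a [^] (e :: int)"
        using conj_a_exponent[OF y] by blast
      have "commutator x y = a [^] (j * (1 - e))"
        using commutator_int_pow[OF a_closed y e(2)] j by simp
      moreover have "m ^ (k - 1) * m dvd j * (1 - e)"
        using j e by (intro mult_dvd_mono) (simp_all add: dvd_diff_commute)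
      ultimately show "commutator x y \<in> generate G {a [^] (m ^ (k - 1) * m)}"
        by (auto simp: int_pow_mem_generate_iff)
    qed (auto intro: generate_is_subgroup)
    moreover have "generate G {a [^] (m ^ (k - 1) * m)} \<subseteq> lower_central G (Suc k)"
      using Suc by (intro lower_central_superset) (auto intro: generate.incl)
    ultimately show ?case
      by (simp only: pow)
  }
qed

end

section \<open>Free groups\<close>

lemma words_append [simp]: "u @ v \<in> words X \<longleftrightarrow> u \<in> words X \<and> v \<in> words X"
  by (simp add: words_def)

lemma words_Nil [simp]: "[] \<in> words X"
  by (simp add: words_def)

lemma words_Cons [simp]: "(x, b) # u \<in> words X \<longleftrightarrow> x \<in> X \<and> u \<in> words X"
  by (simp add: words_def)

lemma free_eq_iff:
  "(u, v) \<in> free_eq X \<longleftrightarrow> u \<in> words X \<and> v \<in> words X \<and> (u, v) \<in> (cancel X \<union> (cancel X)\<inverse>)\<^sup>*"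
  by (auto simp: free_eq_def)

lemma equiv_free_eq: "equiv (words X) (free_eq X)"
proof (rule equivI)
  have "sym ((cancel X \<union> (cancel X)\<inverse>)\<^sup>*)"
    by (rule sym_rtrancl) (auto simp: sym_def)
  then show "sym (free_eq X)"
    by (auto simp: sym_def free_eq_iff)
qed (auto simp: refl_on_def trans_def free_eq_iff)

text \<open>
  A cancellation inside a word remains one when the word is extended on either side; hence
  concatenation is well defined on classes of words.
\<close>

lemma free_eq_append_context:
  assumes "(u, v) \<in> free_eq X" "w \<in> words X" "z \<in> words X"
  shows "(w @ u @ z, w @ v @ z) \<in> free_eq X"
proof -
  have cancel_context: "(w @ u @ z, w @ v @ z) \<in> cancel X" if "(u, v) \<in> cancel X" for u v
  proof -
    from that obtain u1 u2 x b where
      "u = u1 @ [(x, b), (x, \<not> b)] @ u2" "v = u1 @ u2" "u1 \<in> words X" "u2 \<in> words X" "x \<in> X"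
      by (auto simp: cancel_def)
    then show ?thesis
      unfolding cancel_def using assms(2,3)
      by (intro CollectI exI[of _ "w @ u1"] exI[of _ "u2 @ z"] exI[of _ x] exI[of _ b]) auto
  qed
  from assms(1) have "(u, v) \<in> (cancel X \<union> (cancel X)\<inverse>)\<^sup>*"
    by (simp add: free_eq_iff)
  then have "(w @ u @ z, w @ v @ z) \<in> (cancel X \<union> (cancel X)\<inverse>)\<^sup>*"
  proof (induction rule: rtrancl_induct)
    case (step v v')
    then have "(w @ v @ z, w @ v' @ z) \<in> cancel X \<union> (cancel X)\<inverse>"
      using cancel_context by blast
    with step.IH show ?case
      by (rule rtrancl_into_rtrancl)
  qed simp
  with assms show ?thesis
    by (simp add: free_eq_iff)
qed

lemma free_eq_append:
  assumes "(u, u') \<in> free_eq X" "(v, v') \<in> free_eq X"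
  shows "(u @ v, u' @ v') \<in> free_eq X"
proof -
  have "(u @ v, u' @ v) \<in> free_eq X"
    using free_eq_append_context[OF assms(1), of "[]" v] assms by (simp add: free_eq_iff)
  moreover have "(u' @ v, u' @ v') \<in> free_eq X"
    using free_eq_append_context[OF assms(2), of u' "[]"] assms by (simp add: free_eq_iff)
  ultimately show ?thesis
    using equiv_free_eq by (meson equivE transD)
qed

abbreviation word_class :: "'a set \<Rightarrow> 'a word \<Rightarrow> 'a word set" where
  "word_class X u \<equiv> free_eq X `` {u}"

lemma carrier_free_group: "carrier (free_group X) = word_class X ` words X"
  by (auto simp: free_group_def quotient_def)

lemma mult_free_group:
  assumes "u \<in> words X" "v \<in> words X"
  shows "word_class X u \<otimes>\<^bsub>free_group X\<^esub> word_class X v = word_class X (u @ v)"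
proof -
  have "(\<lambda>u v. word_class X (u @ v)) respects2 free_eq X"
    by (rule congruent2I') (metis equiv_class_eq equiv_free_eq free_eq_append)
  then show ?thesis
    using UN_equiv_class2[OF equiv_free_eq equiv_free_eq] assms by (simp add: free_group_def)
qed

lemma one_free_group: "\<one>\<^bsub>free_group X\<^esub> = word_class X []"
  by (simp add: free_group_def)

lemma word_class_cancel:
  assumes "x \<in> X"
  shows "word_class X [(x, b), (x, \<not> b)] = word_class X []"
proof (rule equiv_class_eq[OF equiv_free_eq])
  have "([(x, b), (x, \<not> b)], []) \<in> cancel X"
    unfolding cancel_def using assms
    by (intro CollectI exI[of _ "[]"] exI[of _ x] exI[of _ b]) auto
  then show "([(x, b), (x, \<not> b)], []) \<in> free_eq X"
    using assms by (auto simp: free_eq_iff)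
qed

text \<open>
  The inverse of a word is built one letter at a time: if \<open>v\<close> inverts \<open>w\<close>, then \<open>v\<close> followed by the
  formal inverse of the letter \<open>l\<close> inverts \<open>l # w\<close>.
\<close>

theorem group_free_group: "group (free_group X)"
proof (rule groupI)
  fix g h assume "g \<in> carrier (free_group X)" "h \<in> carrier (free_group X)"
  then show "g \<otimes>\<^bsub>free_group X\<^esub> h \<in> carrier (free_group X)"
    by (auto simp: carrier_free_group mult_free_group)
next
  show "\<one>\<^bsub>free_group X\<^esub> \<in> carrier (free_group X)"
    by (auto simp: carrier_free_group one_free_group)
next
  fix f g h assume "f \<in> carrier (free_group X)" "g \<in> carrier (free_group X)"
    "h \<in> carrier (free_group X)"
  then show "f \<otimes>\<^bsub>free_group X\<^esub> g \<otimes>\<^bsub>free_group X\<^esub> h = f \<otimes>\<^bsub>free_group X\<^esub> (g \<otimes>\<^bsub>free_group X\<^esub> h)"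
    by (auto simp: carrier_free_group mult_free_group)
next
  fix g assume "g \<in> carrier (free_group X)"
  then show "\<one>\<^bsub>free_group X\<^esub> \<otimes>\<^bsub>free_group X\<^esub> g = g"
    by (auto simp: carrier_free_group mult_free_group one_free_group)
next
  fix g assume "g \<in> carrier (free_group X)"
  then obtain w where w: "w \<in> words X" "g = word_class X w"
    by (auto simp: carrier_free_group)
  have "\<exists>v \<in> words X. word_class X (v @ w) = word_class X []"
    using w(1)
  proof (induction w)
    case (Cons l w)
    obtain x b where l: "l = (x, b)" by force
    with Cons obtain v where v: "v \<in> words X" "word_class X (v @ w) = word_class X []"
      by auto
    from l Cons.prems have x: "x \<in> X" and w: "w \<in> words X" by auto
    have "([(x, \<not> b), (x, b)], []) \<in> free_eq X"
      using word_class_cancel[OF x, of "\<not> b"] x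
      by (intro eq_equiv_class[OF _ equiv_free_eq]) auto
    then have "(v @ [(x, \<not> b), (x, b)] @ w, v @ [] @ w) \<in> free_eq X"
      using v w by (intro free_eq_append_context) auto
    then have "word_class X ((v @ [(x, \<not> b)]) @ l # w) = word_class X []"
      using v by (simp add: l equiv_class_eq[OF equiv_free_eq])
    then show ?case
      using v x by (intro bexI[of _ "v @ [(x, \<not> b)]"]) auto
  qed (auto intro: bexI[of _ "[]"])
  then show "\<exists>h \<in> carrier (free_group X). h \<otimes>\<^bsub>free_group X\<^esub> g = \<one>\<^bsub>free_group X\<^esub>"
    using w by (force simp: carrier_free_group mult_free_group one_free_group)
qed

lemma free_gen_closed [simp]: "x \<in> X \<Longrightarrow> free_gen X x \<in> carrier (free_group X)"
  by (auto simp: free_gen_def carrier_free_group)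

lemma inv_free_gen:
  assumes "x \<in> X"
  shows "inv\<^bsub>free_group X\<^esub> (free_gen X x) = word_class X [(x, False)]"
proof -
  interpret group "free_group X" by (rule group_free_group)
  have "word_class X [(x, False)] \<otimes>\<^bsub>free_group X\<^esub> free_gen X x = \<one>\<^bsub>free_group X\<^esub>"
    using assms word_class_cancel[of x X False] by (simp add: free_gen_def mult_free_group one_free_group)
  then show ?thesis
    using assms by (intro inv_equality) (simp_all, auto simp: carrier_free_group)
qed

theorem generate_free_gen: "generate (free_group X) (free_gen X ` X) = carrier (free_group X)"
proof
  interpret group "free_group X" by (rule group_free_group)
  show "generate (free_group X) (free_gen X ` X) \<subseteq> carrier (free_group X)"
    by (rule generate_incl) auto
  have "word_class X w \<in> generate (free_group X) (free_gen X ` X)" if "w \<in> words X" for w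
    using that
  proof (induction w)
    case Nil
    then show ?case
      using generate.one[of "free_group X"] by (simp add: one_free_group)
  next
    case (Cons l w)
    obtain x b where l: "l = (x, b)" by force
    with Cons have x: "x \<in> X" and w: "w \<in> words X"
      and IH: "word_class X w \<in> generate (free_group X) (free_gen X ` X)" by auto
    have "word_class X [(x, b)] \<in> generate (free_group X) (free_gen X ` X)"
    proof (cases b)
      case True
      then show ?thesis
        using generate.incl[OF imageI[OF x, of "free_gen X"]] by (simp add: free_gen_def)
    next
      case False
      then show ?thesis
        using x generate.inv[of "free_gen X x" "free_gen X ` X" "free_group X"]
        by (simp add: inv_free_gen)
    qed
    then have "word_class X [(x, b)] \<otimes>\<^bsub>free_group X\<^esub> word_class X w
        \<in> generate (free_group X) (free_gen X ` X)"
      using IH by (rule generate.eng)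
    then show ?case
      using x w by (simp add: l mult_free_group)
  qed
  then show "carrier (free_group X) \<subseteq> generate (free_group X) (free_gen X ` X)"
    by (auto simp: carrier_free_group)
qed

section \<open>Presentations\<close>

lemma (in group) normal_closure_normal:
  assumes "S \<subseteq> carrier G"
  shows "normal_closure G S \<lhd> G"
  unfolding normal_closure_def
proof (rule normal_invI)
  show "subgroup (\<Inter> {N. N \<lhd> G \<and> S \<subseteq> N}) G"
    using assms normal_self by (intro subgroups_Inter) (auto intro: normal_imp_subgroup)
qed (auto intro: normal_invE)

lemma subset_normal_closure: "S \<subseteq> normal_closure G S"
  by (auto simp: normal_closure_def)

lemma (in normal) rcos_eqI:
  assumes "u \<in> carrier G" "v \<in> carrier G" "u \<otimes> inv v \<in> H"
  shows "H #> u = H #> v"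
proof -
  have "u = u \<otimes> inv v \<otimes> v"
    using assms by (simp add: m_assoc)
  then have "u \<in> H #> v"
    using assms by (auto simp: r_coset_def)
  then show ?thesis
    using assms repr_independence subgroup_axioms by metis
qed

locale group_presentation =
  fixes X :: "'a set" and R :: "('a word set \<times> 'a word set) set"
  assumes R_closed: "R \<subseteq> carrier (free_group X) \<times> carrier (free_group X)"
begin

lemma normal_relators: "relators X R \<lhd> free_group X"
proof -
  interpret group "free_group X" by (rule group_free_group)
  show ?thesis
    unfolding relators_def using R_closed by (intro normal_closure_normal) auto
qed

sublocale relators: normal "relators X R" "free_group X"
  by (rule normal_relators)

sublocale proj: group_hom "free_group X" "presented_group X R"
    "\<lambda>x. relators X R #>\<^bsub>free_group X\<^esub> x"
  unfolding presented_group_def by (rule relators.group_hom_Mod)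

lemma proj_relation:
  assumes "(u, v) \<in> R"
  shows "relators X R #>\<^bsub>free_group X\<^esub> u = relators X R #>\<^bsub>free_group X\<^esub> v"
proof (rule relators.rcos_eqI)
  show "u \<otimes>\<^bsub>free_group X\<^esub> inv\<^bsub>free_group X\<^esub> v \<in> relators X R"
    unfolding relators_def using assms by (intro subsetD[OF subset_normal_closure]) auto
qed (use assms R_closed in auto)

lemma proj_surj:
  "(\<lambda>x. relators X R #>\<^bsub>free_group X\<^esub> x) ` carrier (free_group X) = carrier (presented_group X R)"
  by (simp add: presented_group_def carrier_FactGroup)

end

section \<open>The groups \<open>\<Gamma>\<^sub>n\<^sub>,\<^sub>c\<close>\<close>

lemma Gamma_rels_closed:
  "Gamma_rels r p y \<subseteq> carrier (free_group (Gamma_gens r)) \<times> carrier (free_group (Gamma_gens r))"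
proof -
  interpret group "free_group (Gamma_gens r)" by (rule group_free_group)
  have [simp]: "A \<in> Gamma_gens r" "T i \<in> Gamma_gens r \<longleftrightarrow> i \<in> {1..r}" for i
    by (auto simp: Gamma_gens_def)
  show ?thesis
    by (auto simp: Gamma_rels_def Let_def)
qed

theorem proposition2p6:
  fixes n r m k c :: nat and p y :: "nat \<Rightarrow> nat"
  assumes "n \<ge> 2"
    and "\<And>i. i \<in> {1..r} \<Longrightarrow> prime (p i)"
    and "inj_on p {1..r}"
    and "\<And>i. i \<in> {1..r} \<Longrightarrow> y i > 0"
    and "n = (\<Prod>i = 1..r. p i ^ y i)"
    and "m = Gcd ((\<lambda>i. p i ^ y i - 1) ` {1..r})"
    and "k \<ge> 2"
    and "c \<ge> 1"
  shows "lower_central (Gamma_nil r p y c) k =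
         generate (Gamma_nil r p y c) {a_bar r p y c [^]\<^bsub>Gamma_nil r p y c\<^esub> (m ^ (k - 1))}"
proof -
  define X where "X = Gamma_gens r"
  define F where "F = free_group X"
  define \<Gamma> where "\<Gamma> = Gamma r p y"
  define L where "L = lower_central \<Gamma> (Suc c)"
  define N where "N = Gamma_nil r p y c"
  have N_eq: "N = \<Gamma> Mod L"
    by (simp add: N_def Gamma_nil_def \<Gamma>_def L_def)
  interpret group_presentation X "Gamma_rels r p y"
    unfolding X_def by unfold_locales (rule Gamma_rels_closed)
  have \<Gamma>_eq: "presented_group X (Gamma_rels r p y) = \<Gamma>"
    by (simp add: \<Gamma>_def Gamma_def X_def)
  interpret \<Gamma>: group \<Gamma>
    using proj.H.is_group by (simp add: \<Gamma>_eq)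
  interpret L: normal L \<Gamma>
    unfolding L_def by (rule \<Gamma>.lower_central_normal)
  interpret quot: group_hom \<Gamma> N "\<lambda>x. L #>\<^bsub>\<Gamma>\<^esub> x"
    unfolding N_eq by (rule L.group_hom_Mod)
  \<comment> \<open>All relations are first seen in the free group, so they are transported along the composite
    projection from the free group onto \<open>N\<close>.\<close>
  define \<phi> where "\<phi> = (\<lambda>x. L #>\<^bsub>\<Gamma>\<^esub> (relators X (Gamma_rels r p y) #>\<^bsub>F\<^esub> x))"
  have "\<phi> \<in> hom F N"
    using hom_compose[OF proj.homh[unfolded \<Gamma>_eq] quot.homh] by (simp add: \<phi>_def F_def o_def)
  then interpret \<phi>: group_hom F N \<phi>
    using group_free_group quot.H.is_group by (simp add: group_hom_def group_hom_axioms_def F_def)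
  have \<phi>_surj: "\<phi> ` carrier F = carrier N"
  proof -
    have "\<phi> ` carrier F = (\<lambda>x. L #>\<^bsub>\<Gamma>\<^esub> x) ` carrier \<Gamma>"
      using proj_surj by (simp add: \<phi>_def F_def \<Gamma>_eq flip: image_image)
    then show ?thesis
      by (simp add: N_eq carrier_FactGroup)
  qed
  have \<phi>_rel: "\<phi> u = \<phi> v" if "(u, v) \<in> Gamma_rels r p y" for u v
    using proj_relation[OF that] by (simp add: \<phi>_def F_def)
  define a t where "a = free_gen X A" and "t = (\<lambda>i. free_gen X (T i))"
  have gens: "a \<in> carrier F" "\<And>i. i \<in> {1..r} \<Longrightarrow> t i \<in> carrier F"
    by (auto simp: a_def t_def F_def X_def Gamma_gens_def)
  have a_bar: "\<phi> a = a_bar r p y c"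
    by (simp add: \<phi>_def a_def F_def a_bar_def Gamma_a_def presented_gen_def L_def \<Gamma>_def X_def)
  have q_pos: "1 \<le> p i ^ y i" if "i \<in> {1..r}" for i
    using assms(2)[OF that] by (simp add: Suc_le_eq prime_gt_0_nat)
  interpret act: power_action N "\<phi> a" "{1..r}" "\<lambda>i. \<phi> (t i)" "\<lambda>i. p i ^ y i" c
  proof unfold_locales
    have "insert (\<phi> a) ((\<lambda>i. \<phi> (t i)) ` {1..r}) = \<phi> ` free_gen X ` X"
      by (simp add: a_def t_def X_def Gamma_gens_def image_image)
    then show "generate N (insert (\<phi> a) ((\<lambda>i. \<phi> (t i)) ` {1..r})) = carrier N"
      using \<phi>.generate_img[of "free_gen X ` X"] \<phi>_surj generate_free_gen[of X]
      by (simp add: F_def image_subset_iff)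
  next
    fix i j assume ij: "i \<in> {1..r}" "j \<in> {1..r}"
    show "\<phi> (t i) \<otimes>\<^bsub>N\<^esub> \<phi> (t j) = \<phi> (t j) \<otimes>\<^bsub>N\<^esub> \<phi> (t i)"
    proof (cases "i = j")
      case False
      then have "(t i \<otimes>\<^bsub>F\<^esub> t j, t j \<otimes>\<^bsub>F\<^esub> t i) \<in> Gamma_rels r p y"
        using ij by (auto simp: Gamma_rels_def Let_def t_def F_def X_def)
      from \<phi>_rel[OF this] show ?thesis
        using gens ij by simp
    qed simp
  next
    fix i assume i: "i \<in> {1..r}"
    have "(t i \<otimes>\<^bsub>F\<^esub> a \<otimes>\<^bsub>F\<^esub> inv\<^bsub>F\<^esub> (t i), a [^]\<^bsub>F\<^esub> (p i ^ y i)) \<in> Gamma_rels r p y"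
      using i by (auto simp: Gamma_rels_def Let_def a_def t_def F_def X_def)
    from \<phi>_rel[OF this] show "\<phi> (t i) \<otimes>\<^bsub>N\<^esub> \<phi> a \<otimes>\<^bsub>N\<^esub> inv\<^bsub>N\<^esub> \<phi> (t i) = \<phi> a [^]\<^bsub>N\<^esub> (p i ^ y i)"
      using gens i by (simp add: \<phi>.hom_nat_pow)
  next
    show "lower_central N (Suc c) = {\<one>\<^bsub>N\<^esub>}"
      unfolding N_eq L_def by (rule \<Gamma>.lower_central_Mod_self)
  qed (use gens q_pos assms(8) in auto)
  have "act.m = int m"
    by (simp only: act.m_def assms(6))
  then show ?thesis
    using act.lower_central_eq_generate[OF assms(7)] a_bar
    by (simp add: N_def flip: int_pow_int)
qed

end
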